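(* Let $R>0$, let $\ell\subset\mathbb{R}^2$ be a line not passing through the origin $O$, let $z\in\ell$, and put $w=f_R(z)$. Let $m=Oz$ be the line through $O$ and $z$, and let $m^\perp$ be the line through $O$ perpendicular to $m$. If $m^\perp$ is not parallel to $\ell$, so that $F=\ell\cap m^\perp$ is a finite point, then the tangent line at $w$ to the carrier conic of $f_R(\ell)$ is the line $Fw$. If $m^\perp\parallel\ell$, then the tangent line at $w$ to the carrier conic of $f_R(\ell)$ is parallel to $\ell$.
   Context: $O$ is the origin of $\mathbb{R}^2$ and $\|\cdot\|$ is the Euclidean norm. For $R>0$, the radial cone projection of the plane onto the open disk $D_R=\{x\in\mathbb{R}^2:\|x\|<R\}$ is $f_R(x)=\dfrac{x}{1+\|x\|/R}$. The carrier of an image arc is the complete conic containing that arc. By the (previously known) Self-Directrix Theorem, for a line $\ell=\{x:x\cdot n=d\}$ with $\|n\|=1$ and $d>0$, the carrier conic of $f_R(\ell)$ is the conic with focus $O$, directrix $\ell$, eccentricity $R/d$ and semi-latus rectum $R$. *)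

theory Defs
  imports "HOL-Analysis.Analysis"
begin

definition radial_cone :: "real \<Rightarrow> real^2 \<Rightarrow> real^2" where
  "radial_cone R x = x /\<^sub>R (1 + norm x / R)"

definition is_line :: "(real^2) set \<Rightarrow> bool" where
  "is_line L \<longleftrightarrow> affine L \<and> aff_dim L = 1"

text \<open>A conic is the full real zero set of a quadratic polynomial whose homogenised
  quadratic form is nondegenerate (which forces the degree to be exactly two). A hyperbola
  therefore comprises both of its branches.\<close>

definition is_conic :: "(real^2) set \<Rightarrow> bool" where
  "is_conic C \<longleftrightarrow> (\<exists>a b c d e f :: real.
     det (vector [vector [a, b, d], vector [b, c, e], vector [d, e, f]] :: real^3^3) \<noteq> 0 \<and>
     C = {x. a * (x$1)\<^sup>2 + 2 * b * (x$1) * (x$2) + c * (x$2)\<^sup>2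
             + 2 * d * (x$1) + 2 * e * (x$2) + f = 0})"

definition carrier_conic :: "(real^2) set \<Rightarrow> (real^2) set" where
  "carrier_conic A = (THE C. is_conic C \<and> A \<subseteq> C)"

text \<open>Tangency as the limit of secants, expressed intrinsically in terms of the point set:
  the quotient below is the sine of the angle between \<open>T\<close> and the secant through \<open>w\<close>
  and \<open>x\<close>. The condition that \<open>w\<close> is a limit point of \<open>S\<close> keeps the limit from being
  vacuous.\<close>

definition is_tangent_line :: "(real^2) set \<Rightarrow> real^2 \<Rightarrow> (real^2) set \<Rightarrow> bool" where
  "is_tangent_line S w T \<longleftrightarrow>
     is_line T \<and> w \<in> T \<and> w \<in> S \<and> w islimpt S \<and>
     ((\<lambda>x. infdist x T / dist x w) \<longlongrightarrow> 0) (at w within S)"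

lemma is_tangent_line_unique:
  assumes "is_tangent_line S w T" and "is_tangent_line S w T'"
  shows "T = T'"
proof -
  obtain s where s: "\<And>k. s k \<in> S - {w}" "s \<longlonglongrightarrow> w"
    using assms(1) unfolding is_tangent_line_def islimpt_sequential by blast
  define h where "h k = (s k - w) /\<^sub>R dist (s k) w" for k
  have nh: "norm (h k) = 1" for k
    using s(1)[of k] by (simp add: h_def dist_norm)
  then have "\<forall>k. h k \<in> sphere 0 1" by simp
  then obtain g and r :: "nat \<Rightarrow> nat" where g: "g \<in> sphere 0 1" "strict_mono r"
    "(h \<circ> r) \<longlonglongrightarrow> g"
    using compact_sphere[of 0 "1::real"] unfolding compact_def by metis
  have gin: "w + g \<in> U" if U: "is_tangent_line S w U" for U
  proof -
    have aff: "affine U" and wU: "w \<in> U"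
      using U by (auto simp: is_tangent_line_def is_line_def)
    then have cl: "closed U" and ne: "U \<noteq> {}" by (auto simp: affine_closed)
    have fl: "filterlim s (at w within S) sequentially"
      using s by (auto simp: filterlim_at)
    have lim: "(\<lambda>k. infdist (s k) U / dist (s k) w) \<longlonglongrightarrow> 0"
      using U fl unfolding is_tangent_line_def
      by (auto intro: filterlim_compose[where f = s])
    have le: "infdist (w + h k) U \<le> infdist (s k) U / dist (s k) w" for k
    proof -
      obtain y where y: "y \<in> U" "infdist (s k) U = dist (s k) y"
        using infdist_attains_inf[OF cl ne] by blast
      define c where "c = inverse (dist (s k) w)"
      have c: "c \<ge> 0" by (simp add: c_def)
      have "(1 - c) *\<^sub>R w + c *\<^sub>R y \<in> U"
        using aff wU y(1) by (auto simp: affine_alt)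
      then have "infdist (w + h k) U \<le> dist (w + h k) ((1 - c) *\<^sub>R w + c *\<^sub>R y)"
        by (rule infdist_le)
      also have "\<dots> = norm (c *\<^sub>R (s k - y))"
      proof -
        have "w + h k - ((1 - c) *\<^sub>R w + c *\<^sub>R y) = c *\<^sub>R (s k - y)"
          unfolding h_def c_def[symmetric] by (simp add: algebra_simps)
        then show ?thesis by (simp only: dist_norm)
      qed
      also have "\<dots> = infdist (s k) U / dist (s k) w"
        using c y by (simp add: dist_norm c_def divide_inverse mult.commute)
      finally show ?thesis .
    qed
    have l0: "(\<lambda>k. infdist (w + h k) U) \<longlonglongrightarrow> 0"
      by (rule tendsto_sandwich[OF _ _ tendsto_const lim]) (auto simp: le infdist_nonneg)
    have "(\<lambda>k. infdist (w + h (r k)) U) \<longlonglongrightarrow> 0"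
      using LIMSEQ_subseq_LIMSEQ[OF l0 g(2)] by (simp add: o_def)
    moreover have "(\<lambda>k. infdist (w + h (r k)) U) \<longlonglongrightarrow> infdist (w + g) U"
      using g(3) by (intro tendsto_infdist tendsto_intros) (simp add: o_def)
    ultimately have "infdist (w + g) U = 0" using LIMSEQ_unique by blast
    then show ?thesis using cl ne in_closed_iff_infdist_zero by blast
  qed
  have hull: "U = affine hull {w, w + g}" if U: "is_tangent_line S w U" for U
  proof -
    have "g \<noteq> 0" using g(1) by auto
    then have d: "aff_dim (affine hull {w, w + g}) = 1" by (simp add: aff_dim_2)
    have a: "affine U" "aff_dim U = 1" "w \<in> U"
      using U by (auto simp: is_tangent_line_def is_line_def)
    have "affine hull {w, w + g} \<subseteq> U"
      using a gin[OF U] by (intro hull_minimal) auto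
    then show ?thesis
      using affine_dim_equal[of "affine hull {w, w + g}" U] a d by auto
  qed
  show ?thesis using hull assms by metis
qed

end

theory Submission
  imports Defs
begin

text \<open>
  A line \<open>l\<close> that misses the origin is \<open>{x. p \<bullet> x = 1}\<close> for a unique normal \<open>p\<close>. If \<open>w\<close> is the
  image of \<open>z \<in> l\<close>, then \<open>w = s z\<close> with \<open>s = 1 / (1 + \<parallel>z\<parallel> / R)\<close>, and \<open>s\<close> can be read off from \<open>w\<close>
  in two ways: \<open>s = p \<bullet> w\<close> and \<open>s = 1 - \<parallel>w\<parallel> / R\<close>. Hence the image is the part \<open>p \<bullet> x > 0\<close> of the
  focus-directrix curve \<open>\<parallel>x\<parallel> = R (1 - p \<bullet> x)\<close>, and squaring this equation gives a conic with
  focus at the origin and directrix \<open>l\<close>.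

  This conic is the carrier because no other conic contains the image
  (\<open>conic_containing_arc_unique\<close>). In the orthogonal frame given by \<open>p\<close> and its quarter turn, the
  image is symmetric about the axis \<open>p\<close>, so a quadratic polynomial that vanishes on it has no
  monomial of odd degree in the transverse coordinate \<open>v\<close>. Eliminating \<open>v\<^sup>2\<close> leaves a quadratic
  in the axial coordinate which vanishes on an interval, hence identically; the polynomial
  is therefore a multiple of the focus-directrix polynomial.

  Half the gradient of \<open>\<parallel>x\<parallel>\<^sup>2 - R\<^sup>2 (1 - p \<bullet> x)\<^sup>2\<close> at \<open>w\<close> is \<open>g = w + R \<parallel>w\<parallel> p\<close>, and the
  remainder after the linear term is quadratic, so the line \<open>g \<bullet> (x - w) = 0\<close> is tangent at
  \<open>w\<close>. It remains to locate this line. If \<open>F \<in> l\<close> is orthogonal to \<open>z\<close>, and hence to \<open>w\<close>, then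
  \<open>g \<bullet> (F - w) = - \<parallel>w\<parallel>\<^sup>2 + R \<parallel>w\<parallel> (1 - p \<bullet> w) = 0\<close>, so the tangent passes through \<open>F\<close>. If the
  perpendicular at the origin is parallel to \<open>l\<close>, its directions are orthogonal to both \<open>w\<close> and
  \<open>p\<close>, hence to \<open>g\<close>, and they are the directions of the tangent.
\<close>

section \<open>The image of a line under the radial cone projection\<close>

lemma line_not_through_origin:
  assumes "is_line l" "0 \<notin> l"
  obtains p where "p \<noteq> 0" "l = {x. p \<bullet> x = 1}"
proof -
  have "\<exists>a b. a \<noteq> 0 \<and> affine hull l = {x. a \<bullet> x = b}"
    using assms(1) unfolding aff_dim_eq_hyperplane[symmetric] by (simp add: is_line_def)
  moreover have "affine hull l = l"
    using assms(1) by (simp add: is_line_def)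
  ultimately obtain a b where ab: "a \<noteq> 0" "l = {x. a \<bullet> x = b}"
    by auto
  with assms have "b \<noteq> 0" by auto
  with ab have "a /\<^sub>R b \<noteq> 0" "l = {x. (a /\<^sub>R b) \<bullet> x = 1}"
    by (auto simp: field_simps)
  then show thesis by (rule that)
qed

text \<open>The polar equation of the image arc. Conversely, a point \<open>x\<close> of the curve
  is the image of the point \<open>x /\<^sub>R (p \<bullet> x)\<close> in which the ray through \<open>x\<close> meets the line.\<close>

lemma radial_cone_image_line:
  assumes "R > 0"
  shows "radial_cone R ` {x. p \<bullet> x = 1} = {x. norm x = R * (1 - p \<bullet> x) \<and> p \<bullet> x > 0}"
    (is "_ ` ?l = ?A")
proof
  show "radial_cone R ` ?l \<subseteq> ?A"
  proof
    fix x assume "x \<in> radial_cone R ` ?l"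
    then obtain z where z: "p \<bullet> z = 1" "x = radial_cone R z" by auto
    have pos: "1 + norm z / R > 0"
      using assms by (simp add: add_pos_nonneg)
    have "p \<bullet> x = 1 / (1 + norm z / R)" "norm x = norm z / (1 + norm z / R)"
      using z pos by (simp_all add: radial_cone_def divide_inverse mult.commute)
    moreover have "R * (1 - 1 / (1 + norm z / R)) = norm z / (1 + norm z / R)"
      using pos assms by (simp add: field_simps)
    ultimately show "x \<in> ?A" using pos by simp
  qed
  show "?A \<subseteq> radial_cone R ` ?l"
  proof
    fix x assume x: "x \<in> ?A"
    define z where "z = x /\<^sub>R (p \<bullet> x)"
    have "norm z = R * (1 - p \<bullet> x) / (p \<bullet> x)"
      using x by (simp add: z_def divide_inverse mult.commute)
    then have "1 + norm z / R = 1 / (p \<bullet> x)"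
      using x assms by (simp add: field_simps)
    then have "radial_cone R z = x" "p \<bullet> z = 1"
      using x by (simp_all add: radial_cone_def z_def)
    then show "x \<in> radial_cone R ` ?l" by force
  qed
qed

lemma continuous_on_radial_cone:
  assumes "R > 0"
  shows "continuous_on S (radial_cone R)"
proof -
  have "1 + norm x / R \<noteq> 0" for x :: "real^2"
    using assms by (metis add_pos_nonneg divide_nonneg_pos less_irrefl norm_ge_zero zero_less_one)
  then show ?thesis
    unfolding radial_cone_def using assms by (intro continuous_intros) auto
qed

text \<open>Every point is a limit point because the arc is connected and has more than one point.\<close>

lemma islimpt_radial_cone_image_line:
  assumes "R > 0" "is_line l" "0 \<notin> l" "w \<in> radial_cone R ` l"
  shows "w islimpt radial_cone R ` l"
proof (rule connected_imp_perfect)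
  obtain p where p: "l = {x. p \<bullet> x = 1}"
    using line_not_through_origin assms by blast
  have "convex l"
    using assms by (simp add: is_line_def affine_imp_convex)
  then show "connected (radial_cone R ` l)"
    by (intro connected_continuous_image continuous_on_radial_cone assms convex_connected)
  have "inj_on (radial_cone R) l"
  proof
    fix x y assume xy: "x \<in> l" "y \<in> l" "radial_cone R x = radial_cone R y"
    have pos: "1 + norm u / R > 0" for u :: "real^2"
      using assms by (simp add: add_pos_nonneg)
    \<comment> \<open>Pairing with \<open>p\<close> shows that the two scaling factors agree.\<close>
    have "p \<bullet> radial_cone R x = p \<bullet> radial_cone R y" using xy by simp
    then have eq: "1 + norm x / R = 1 + norm y / R"
      using xy(1,2) by (simp add: radial_cone_def p)
    show "x = y"
      using xy(3) pos[of y] unfolding radial_cone_def eq by auto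
  qed
  moreover have "l \<noteq> {a}" for a
    using assms(2) by (auto simp: is_line_def)
  moreover have "l = {z}" if "inj_on (radial_cone R) l" "radial_cone R ` l = {b}" "z \<in> l" for b z
  proof
    show "l \<subseteq> {z}"
    proof
      fix x assume "x \<in> l"
      then have "radial_cone R x \<in> {b}" "radial_cone R z \<in> {b}"
        unfolding that(2)[symmetric] using that(3) by simp_all
      then have "radial_cone R x = radial_cone R z" by simp
      then show "x \<in> {z}" using inj_onD[OF that(1)] that(3) \<open>x \<in> l\<close> by blast
    qed
  qed (use that in simp)
  ultimately show "radial_cone R ` l \<noteq> {b}" for b
    using assms(4) by (metis imageE)
qed (rule assms(4))

section \<open>The carrier conic\<close>

text \<open>The conic with focus at the origin, directrix \<open>p \<bullet> x = 1\<close> and semi-latus rectum \<open>R\<close>.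
  Squaring the focus-directrix relation adds the second branch of a hyperbola.\<close>

definition focal_conic :: "real \<Rightarrow> real^2 \<Rightarrow> (real^2) set" where
  "focal_conic R p = {x. (norm x)\<^sup>2 = R\<^sup>2 * (1 - p \<bullet> x)\<^sup>2}"

text \<open>The symmetric matrix is \<open>diag 1 1 0 - R\<^sup>2 q q\<^sup>T\<close> with \<open>q = (p\<^sub>1, p\<^sub>2, -1)\<close>; its
  determinant is \<open>- R\<^sup>2\<close>.\<close>

lemma is_conic_focal_conic:
  assumes "R > 0"
  shows "is_conic (focal_conic R p)"
proof -
  let ?a = "1 - R\<^sup>2 * (p$1)\<^sup>2" and ?b = "- (R\<^sup>2 * (p$1) * (p$2))"
    and ?c = "1 - R\<^sup>2 * (p$2)\<^sup>2" and ?d = "R\<^sup>2 * (p$1)" and ?e = "R\<^sup>2 * (p$2)" and ?f = "- R\<^sup>2"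
  have "det (vector [vector [?a, ?b, ?d], vector [?b, ?c, ?e], vector [?d, ?e, ?f]] :: real^3^3)
      = - R\<^sup>2"
    by (simp add: det_3) algebra
  moreover have "focal_conic R p = {x. ?a * (x$1)\<^sup>2 + 2 * ?b * (x$1) * (x$2) + ?c * (x$2)\<^sup>2
             + 2 * ?d * (x$1) + 2 * ?e * (x$2) + ?f = 0}"
    unfolding focal_conic_def power2_norm_eq_inner
    by (auto simp: inner_vec_def sum_2 algebra_simps power2_eq_square)
  moreover have "- R\<^sup>2 \<noteq> 0" using assms by simp
  ultimately show ?thesis
    unfolding is_conic_def by (intro exI conjI) (erule ssubst, assumption+)
qed

lemma quadratic_zero_on_interval:
  fixes a b c \<delta> :: real
  assumes "\<delta> > 0" and zero: "\<And>u. 0 < u \<Longrightarrow> u < \<delta> \<Longrightarrow> a * u\<^sup>2 + b * u + c = 0"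
  shows "a = 0" "b = 0" "c = 0"
proof -
  have 1: "a * \<delta>\<^sup>2 / 16 + b * \<delta> / 4 + c = 0"
    using zero[of "\<delta> / 4"] assms(1) by (simp add: power_divide)
  have 2: "a * \<delta>\<^sup>2 / 4 + b * \<delta> / 2 + c = 0"
    using zero[of "\<delta> / 2"] assms(1) by (simp add: power_divide)
  have 3: "a * \<delta>\<^sup>2 * 9 / 16 + b * \<delta> * 3 / 4 + c = 0"
    using zero[of "\<delta> * 3 / 4"] assms(1) by (simp add: power_divide power_mult_distrib)
  have "a * \<delta>\<^sup>2 = 0" "b * \<delta> = 0" "c = 0" using 1 2 3 by linarith+
  then show "a = 0" "b = 0" "c = 0" using assms(1) by auto
qed

text \<open>The heart of the uniqueness of the carrier, in coordinates \<open>(u, v)\<close> along the axis and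
  across it, with \<open>P = \<parallel>p\<parallel>\<^sup>2\<close>. The conic equation then reads \<open>v\<^sup>2 = R\<^sup>2 (1 - u P)\<^sup>2 / P - u\<^sup>2\<close>.\<close>

lemma quadratic_vanishing_on_arc:
  fixes a b c d e f P R :: real
  assumes "R > 0" "P > 0"
    and zero: "\<And>u v. 0 < u \<Longrightarrow> u * P < 1 \<Longrightarrow> P * (u\<^sup>2 + v\<^sup>2) = R\<^sup>2 * (1 - u * P)\<^sup>2 \<Longrightarrow>
        a * u\<^sup>2 + 2 * b * u * v + c * v\<^sup>2 + 2 * d * u + 2 * e * v + f = 0"
  shows "a * u\<^sup>2 + 2 * b * u * v + c * v\<^sup>2 + 2 * d * u + 2 * e * v + f
       = c / P * (P * (u\<^sup>2 + v\<^sup>2) - R\<^sup>2 * (1 - u * P)\<^sup>2)"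
proof -
  \<comment> \<open>The axial coordinate of the vertex; every smaller positive \<open>u\<close> belongs to two points.\<close>
  define \<delta> where "\<delta> = R / (R * P + sqrt P)"
  have den: "R * P + sqrt P > 0" using assms by (simp add: add_pos_pos)
  have "\<delta> > 0" using den assms by (simp add: \<delta>_def)
  have arc: "b * u + e = 0" "a * u\<^sup>2 + c * (R\<^sup>2 * (1 - u * P)\<^sup>2 / P - u\<^sup>2) + 2 * d * u + f = 0"
    if u: "0 < u" "u < \<delta>" for u
  proof -
    have "u * (R * P + sqrt P) < R"
      using u den by (simp add: \<delta>_def pos_less_divide_eq)
    then have lt: "u * sqrt P < R * (1 - u * P)" by (simp add: algebra_simps)
    have nn: "0 < u * sqrt P" using u assms by simp
    then have "0 < R * (1 - u * P)" using lt by linarith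
    then have uP: "u * P < 1" using assms by (simp add: zero_less_mult_iff)
    have "(u * sqrt P)\<^sup>2 < (R * (1 - u * P))\<^sup>2"
      using lt nn by (intro power_strict_mono) auto
    then have pos: "R\<^sup>2 * (1 - u * P)\<^sup>2 / P - u\<^sup>2 > 0"
      using assms by (simp add: power_mult_distrib pos_less_divide_eq)
    define v where "v = sqrt (R\<^sup>2 * (1 - u * P)\<^sup>2 / P - u\<^sup>2)"
    have v: "v > 0" "v\<^sup>2 = R\<^sup>2 * (1 - u * P)\<^sup>2 / P - u\<^sup>2"
      using pos by (simp_all add: v_def)
    then have on: "P * (u\<^sup>2 + v\<^sup>2) = R\<^sup>2 * (1 - u * P)\<^sup>2"
      using assms by simp
    have plus: "a * u\<^sup>2 + 2 * b * u * v + c * v\<^sup>2 + 2 * d * u + 2 * e * v + f = 0"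
      using zero[OF u(1) uP on] .
    have minus: "a * u\<^sup>2 - 2 * b * u * v + c * v\<^sup>2 + 2 * d * u - 2 * e * v + f = 0"
      using zero[OF u(1) uP, of "- v"] on by simp
    have "(b * u + e) * v = 0" using plus minus by (simp add: algebra_simps)
    then show "b * u + e = 0" using v by simp
    show "a * u\<^sup>2 + c * (R\<^sup>2 * (1 - u * P)\<^sup>2 / P - u\<^sup>2) + 2 * d * u + f = 0"
      using plus minus unfolding v(2)[symmetric] by linarith
  qed
  have odd: "b = 0" "e = 0"
    using quadratic_zero_on_interval[OF \<open>\<delta> > 0\<close>, of 0 b e] arc(1) by auto
  have "(a - c + c * R\<^sup>2 * P) * u\<^sup>2 + (2 * d - 2 * c * R\<^sup>2) * u + (f + c * R\<^sup>2 / P) = 0"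
    if "0 < u" "u < \<delta>" for u
    using arc(2)[OF that] assms by (simp add: field_simps power2_eq_square)
  from quadratic_zero_on_interval[OF \<open>\<delta> > 0\<close> this]
  have even: "a = c - c * R\<^sup>2 * P" "d = c * R\<^sup>2" "f = - (c * R\<^sup>2 / P)" by auto
  show ?thesis
    unfolding odd even using assms by (simp add: field_simps power2_eq_square)
qed

lemma conic_containing_arc_unique:
  assumes "R > 0" "p \<noteq> 0" "is_conic C"
    and sub: "{x. norm x = R * (1 - p \<bullet> x) \<and> p \<bullet> x > 0} \<subseteq> C"
  shows "C = focal_conic R p"
proof -
  obtain a b c d e f where
    det: "det (vector [vector [a, b, d], vector [b, c, e], vector [d, e, f]] :: real^3^3) \<noteq> 0"
    and C: "C = {x. a * (x$1)\<^sup>2 + 2 * b * (x$1) * (x$2) + c * (x$2)\<^sup>2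
             + 2 * d * (x$1) + 2 * e * (x$2) + f = 0}"
    using assms(3) unfolding is_conic_def by blast
  define q where "q s t = a * s\<^sup>2 + 2 * b * s * t + c * t\<^sup>2 + 2 * d * s + 2 * e * t + f" for s t
  have Cq: "x \<in> C \<longleftrightarrow> q (x$1) (x$2) = 0" for x by (simp add: C q_def)
  define P where "P = p \<bullet> p"
  have P: "P > 0" "P = (p$1)\<^sup>2 + (p$2)\<^sup>2"
    using assms(2) by (simp add: P_def) (simp add: P_def inner_vec_def sum_2 power2_eq_square)
  \<comment> \<open>The coefficients of the same quadratic polynomial in the frame \<open>p\<close>, \<open>p\<^sup>\<bottom>\<close>.\<close>
  define a' where "a' = a * (p$1)\<^sup>2 + 2 * b * (p$1) * (p$2) + c * (p$2)\<^sup>2"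
  define b' where "b' = - a * (p$1) * (p$2) + b * ((p$1)\<^sup>2 - (p$2)\<^sup>2) + c * (p$1) * (p$2)"
  define c' where "c' = a * (p$2)\<^sup>2 - 2 * b * (p$1) * (p$2) + c * (p$1)\<^sup>2"
  define d' where "d' = d * (p$1) + e * (p$2)"
  define e' where "e' = - d * (p$2) + e * (p$1)"
  have frame: "q (u * p$1 - v * p$2) (u * p$2 + v * p$1)
      = a' * u\<^sup>2 + 2 * b' * u * v + c' * v\<^sup>2 + 2 * d' * u + 2 * e' * v + f" for u v
    unfolding q_def a'_def b'_def c'_def d'_def e'_def
    by (simp add: algebra_simps power2_eq_square)
  have zero: "a' * u\<^sup>2 + 2 * b' * u * v + c' * v\<^sup>2 + 2 * d' * u + 2 * e' * v + f = 0"
    if u: "0 < u" "u * P < 1" and on: "P * (u\<^sup>2 + v\<^sup>2) = R\<^sup>2 * (1 - u * P)\<^sup>2" for u v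
  proof -
    define x :: "real^2" where "x = vector [u * p$1 - v * p$2, u * p$2 + v * p$1]"
    have x: "x$1 = u * p$1 - v * p$2" "x$2 = u * p$2 + v * p$1" by (simp_all add: x_def)
    have px: "p \<bullet> x = u * P"
      by (simp add: inner_vec_def sum_2 x P(2) algebra_simps power2_eq_square)
    have "(norm x)\<^sup>2 = P * (u\<^sup>2 + v\<^sup>2)"
      unfolding power2_norm_eq_inner
      by (simp add: inner_vec_def sum_2 x P(2) algebra_simps power2_eq_square)
    then have "(norm x)\<^sup>2 = (R * (1 - p \<bullet> x))\<^sup>2" by (simp add: on px power_mult_distrib)
    moreover have "0 \<le> R * (1 - p \<bullet> x)"
      using u assms(1) by (simp add: px)
    ultimately have "norm x = R * (1 - p \<bullet> x)"
      using power2_eq_imp_eq norm_ge_zero by blast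
    then have "x \<in> C" using sub u P(1) by (auto simp: px)
    then show ?thesis using frame[of u v] by (simp add: Cq x)
  qed
  have multiple: "q (x$1) (x$2) = c' / P * ((norm x)\<^sup>2 - R\<^sup>2 * (1 - p \<bullet> x)\<^sup>2)" for x :: "real^2"
  proof -
    define u v where "u = (p \<bullet> x) / P" and "v = (p$1 * x$2 - p$2 * x$1) / P"
    have uv: "u * P = p$1 * x$1 + p$2 * x$2" "v * P = p$1 * x$2 - p$2 * x$1"
      using P(1) by (simp_all add: u_def v_def inner_vec_def sum_2)
    have "P * (u * p$1 - v * p$2) = (u * P) * p$1 - (v * P) * p$2"
      "P * (u * p$2 + v * p$1) = (u * P) * p$2 + (v * P) * p$1"
      by (simp_all add: algebra_simps)
    then have "P * (u * p$1 - v * p$2) = P * x$1" "P * (u * p$2 + v * p$1) = P * x$2"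
      unfolding uv by (simp_all add: P(2) algebra_simps power2_eq_square)
    then have x: "u * p$1 - v * p$2 = x$1" "u * p$2 + v * p$1 = x$2"
      using P(1) by simp_all
    have "(norm x)\<^sup>2 = P * (u\<^sup>2 + v\<^sup>2)"
      unfolding power2_norm_eq_inner
      by (simp add: inner_vec_def sum_2 x[symmetric] P(2) algebra_simps power2_eq_square)
    moreover have "p \<bullet> x = u * P" using P(1) by (simp add: u_def)
    moreover have "q (x$1) (x$2) = c' / P * (P * (u\<^sup>2 + v\<^sup>2) - R\<^sup>2 * (1 - u * P)\<^sup>2)"
      unfolding frame[of u v, unfolded x]
      by (rule quadratic_vanishing_on_arc[OF assms(1) P(1)]) (rule zero)
    ultimately show ?thesis by (simp only:)
  qed
  have "c' \<noteq> 0"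
  proof
    assume "c' = 0"
    have q0: "q s t = 0" for s t
      using multiple[of "vector [s, t]"] \<open>c' = 0\<close> by simp
    have "f = 0" "a + 2 * d + f = 0" "a - 2 * d + f = 0"
      "c + 2 * e + f = 0" "c - 2 * e + f = 0"
      using q0[of 0 0] q0[of 1 0] q0[of "-1" 0] q0[of 0 1] q0[of 0 "-1"]
      by (simp_all add: q_def)
    then have "d = 0" "e = 0" "f = 0" by linarith+
    then have "det (vector [vector [a, b, d], vector [b, c, e], vector [d, e, f]] :: real^3^3) = 0"
      by (simp add: det_3)
    with det show False by simp
  qed
  then show ?thesis
    using P(1) by (auto simp: Cq multiple focal_conic_def)
qed

lemma carrier_conic_radial_cone_line:
  assumes "R > 0" "p \<noteq> 0"
  shows "carrier_conic (radial_cone R ` {x. p \<bullet> x = 1}) = focal_conic R p"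
  unfolding carrier_conic_def radial_cone_image_line[OF assms(1)]
proof (rule the_equality)
  show "is_conic (focal_conic R p) \<and>
      {x. norm x = R * (1 - p \<bullet> x) \<and> p \<bullet> x > 0} \<subseteq> focal_conic R p"
    using is_conic_focal_conic[OF assms(1)] by (auto simp: focal_conic_def power_mult_distrib)
qed (use conic_containing_arc_unique[OF assms] in blast)

section \<open>The tangent line\<close>

text \<open>The distance from \<open>x\<close> to the line is \<open>\<bar>g \<bullet> (x - w)\<bar> / \<parallel>g\<parallel>\<close>, attained at the foot of the
  perpendicular. A second-order bound on \<open>g \<bullet> (x - w)\<close> therefore makes the sine of the angle
  between secant and line of first order in \<open>\<parallel>x - w\<parallel>\<close>.\<close>

lemma is_tangent_line_if_quadratic:
  fixes g w :: "real^2"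
  assumes "g \<noteq> 0" "w \<in> S" "w islimpt S"
    and quad: "\<And>x. x \<in> S \<Longrightarrow> \<bar>g \<bullet> (x - w)\<bar> \<le> K * (norm (x - w))\<^sup>2"
    and T: "is_line T" "w \<in> T" "\<And>x. x \<in> T \<Longrightarrow> g \<bullet> (x - w) = 0"
  shows "is_tangent_line S w T"
proof -
  have T_eq: "T = {x. g \<bullet> x = g \<bullet> w}"
  proof (rule affine_dim_equal)
    show "T \<subseteq> {x. g \<bullet> x = g \<bullet> w}" using T(3) by (auto simp: inner_diff_right)
    show "aff_dim T = aff_dim {x. g \<bullet> x = g \<bullet> w}"
      using T(1) assms(1) by (simp add: is_line_def)
  qed (use T in \<open>auto simp: is_line_def affine_hyperplane\<close>)
  have bound: "infdist x T / dist x w \<le> K / norm g * dist x w" if x: "x \<in> S" "x \<noteq> w" for x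
  proof -
    define y where "y = x - (g \<bullet> (x - w) / (g \<bullet> g)) *\<^sub>R g"
    have "y \<in> T"
      using assms(1) by (simp add: T_eq y_def inner_diff_right)
    then have "infdist x T \<le> dist x y" by (rule infdist_le)
    also have "\<dots> = \<bar>g \<bullet> (x - w)\<bar> / norm g"
      using assms(1)
      by (simp add: y_def dist_norm power2_norm_eq_inner[symmetric] power2_eq_square)
    also have "\<dots> \<le> K * (norm (x - w))\<^sup>2 / norm g"
      using quad[OF x(1)] by (simp add: divide_right_mono)
    finally show ?thesis
      using x assms(1) by (simp add: dist_norm field_simps power2_eq_square)
  qed
  have "((\<lambda>x. infdist x T / dist x w) \<longlongrightarrow> 0) (at w within S)"
  proof (rule tendsto_sandwich)
    show "\<forall>\<^sub>F x in at w within S. 0 \<le> infdist x T / dist x w"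
      by (simp add: infdist_nonneg)
    show "\<forall>\<^sub>F x in at w within S. infdist x T / dist x w \<le> K / norm g * dist x w"
      using bound by (auto simp: eventually_at_filter)
    have "((\<lambda>x. K / norm g * dist x w) \<longlongrightarrow> K / norm g * dist w w) (at w within S)"
      by (intro tendsto_intros)
    then show "((\<lambda>x. K / norm g * dist x w) \<longlongrightarrow> 0) (at w within S)" by simp
  qed (rule tendsto_const)
  then show ?thesis
    using assms T by (simp add: is_tangent_line_def)
qed

text \<open>Positivity of \<open>w \<bullet> g\<close> is what makes the conic smooth at \<open>w\<close>.\<close>

lemma is_tangent_line_focal_conic:
  assumes "R > 0" and w: "norm w = R * (1 - p \<bullet> w)" "p \<bullet> w > 0"
    and lim: "w islimpt focal_conic R p"
    and T: "is_line T" "w \<in> T" "\<And>x. x \<in> T \<Longrightarrow> (w + (R * norm w) *\<^sub>R p) \<bullet> (x - w) = 0"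
  shows "is_tangent_line (focal_conic R p) w T"
proof (rule is_tangent_line_if_quadratic[OF _ _ lim _ T])
  let ?g = "w + (R * norm w) *\<^sub>R p"
  have "w \<noteq> 0" using w(2) by auto
  then have "w \<bullet> w > 0" "R * norm w * (p \<bullet> w) > 0"
    using assms(1) w(2) by simp_all
  then have "w \<bullet> ?g > 0"
    by (simp only: inner_add_right inner_scaleR_right inner_commute[of w p] add_pos_pos)
  then show "?g \<noteq> 0" by (metis inner_zero_right less_irrefl)
  show "w \<in> focal_conic R p"
    by (simp add: focal_conic_def w(1) power_mult_distrib)
  show "\<bar>?g \<bullet> (x - w)\<bar> \<le> ((1 + R\<^sup>2 * (norm p)\<^sup>2) / 2) * (norm (x - w))\<^sup>2"
    if x: "x \<in> focal_conic R p" for x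
  proof -
    define h where "h = x - w"
    have xh: "x = w + h" by (simp add: h_def)
    have nx: "(norm x)\<^sup>2 = (norm w)\<^sup>2 + 2 * (w \<bullet> h) + (norm h)\<^sup>2"
      unfolding power2_norm_eq_inner xh by (simp add: inner_simps inner_commute)
    have "R\<^sup>2 * (1 - p \<bullet> x)\<^sup>2
        = (R * (1 - p \<bullet> w))\<^sup>2 - 2 * R * (R * (1 - p \<bullet> w)) * (p \<bullet> h) + R\<^sup>2 * (p \<bullet> h)\<^sup>2"
      unfolding xh inner_add_right by (simp add: algebra_simps power2_eq_square)
    then have "R\<^sup>2 * (1 - p \<bullet> x)\<^sup>2
        = (norm w)\<^sup>2 - 2 * R * norm w * (p \<bullet> h) + R\<^sup>2 * (p \<bullet> h)\<^sup>2"
      unfolding w(1)[symmetric] .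
    then have eq: "2 * (?g \<bullet> h) = R\<^sup>2 * (p \<bullet> h)\<^sup>2 - (norm h)\<^sup>2"
      using x nx by (simp add: focal_conic_def inner_simps)
    have "(p \<bullet> h)\<^sup>2 \<le> (norm p)\<^sup>2 * (norm h)\<^sup>2"
      using Cauchy_Schwarz_ineq[of p h] by (simp add: power2_norm_eq_inner)
    then have "R\<^sup>2 * (p \<bullet> h)\<^sup>2 \<le> R\<^sup>2 * (norm p)\<^sup>2 * (norm h)\<^sup>2"
      by (simp add: mult.assoc mult_left_mono)
    moreover have "0 \<le> R\<^sup>2 * (p \<bullet> h)\<^sup>2" "0 \<le> R\<^sup>2 * (norm p)\<^sup>2 * (norm h)\<^sup>2" "0 \<le> (norm h)\<^sup>2"
      by simp_all
    ultimately have "\<bar>2 * (?g \<bullet> h)\<bar> \<le> R\<^sup>2 * (norm p)\<^sup>2 * (norm h)\<^sup>2 + (norm h)\<^sup>2"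
      unfolding eq by linarith
    also have "\<bar>2 * (?g \<bullet> h)\<bar> = 2 * \<bar>?g \<bullet> h\<bar>"
      by (simp only: abs_mult abs_numeral)
    also have "R\<^sup>2 * (norm p)\<^sup>2 * (norm h)\<^sup>2 + (norm h)\<^sup>2 = (1 + R\<^sup>2 * (norm p)\<^sup>2) * (norm h)\<^sup>2"
      by (simp only: ring_distribs mult_1_left add.commute)
    finally show ?thesis
      unfolding h_def[symmetric] times_divide_eq_left pos_le_divide_eq[OF zero_less_numeral]
      by (simp only: mult.commute)
  qed
qed

section \<open>The perpendicular at the origin\<close>

lemma orthogonal_comp_affine_hull_origin:
  "orthogonal_comp (affine hull {0, z}) = {y. z \<bullet> y = 0}"
proof -
  have "affine hull {0, z} = span {z}"
    by (simp add: affine_hull_span_0 hull_inc)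
  then show ?thesis
    by (auto simp: orthogonal_comp_def span_singleton orthogonal_def inner_commute)
qed

text \<open>The quarter turn \<open>r\<close> of \<open>z\<close> spans the perpendicular. If \<open>p \<bullet> r \<noteq> 0\<close>, a unique multiple of
  \<open>r\<close> lies on the line; otherwise \<open>p\<close> is a multiple of \<open>z\<close>, which makes the lines parallel.\<close>

lemma perpendicular_meets_line:
  fixes p z :: "real^2"
  assumes "p \<bullet> z = 1" and np: "\<not> affine_parallel {y. z \<bullet> y = 0} {x. p \<bullet> x = 1}"
  obtains F where "{x. p \<bullet> x = 1} \<inter> {y. z \<bullet> y = 0} = {F}"
proof -
  define D where "D = p$2 * z$1 - p$1 * z$2"
  have pz: "p$1 * z$1 + p$2 * z$2 = 1"
    using assms(1) by (simp add: inner_vec_def sum_2)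
  have "D \<noteq> 0"
  proof
    assume D: "D = 0"
    have "(p \<bullet> p) *\<^sub>R z = p"
    proof -
      have "(p \<bullet> p) * z$1 = (p$1 * z$1 + p$2 * z$2) * p$1 + p$2 * D"
        "(p \<bullet> p) * z$2 = (p$1 * z$1 + p$2 * z$2) * p$2 - p$1 * D"
        by (simp_all add: D_def inner_vec_def sum_2 algebra_simps)
      then show ?thesis by (simp add: vec_eq_iff forall_2 pz D)
    qed
    moreover have "p \<bullet> p \<noteq> 0" using assms(1) by auto
    ultimately have "p \<bullet> y = 0 \<longleftrightarrow> z \<bullet> y = 0" for y
      by (metis inner_scaleR_left mult_eq_0_iff)
    then have "p \<bullet> x = 1 \<longleftrightarrow> z \<bullet> (x - z) = 0" for x
      using assms(1) by (metis inner_diff_right eq_iff_diff_eq_0)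
    then have "{x. p \<bullet> x = 1} = {x. x - z \<in> {y. z \<bullet> y = 0}}" by simp
    also have "\<dots> = (\<lambda>y. z + y) ` {y. z \<bullet> y = 0}" (is "?A = ?B")
    proof
      show "?A \<subseteq> ?B"
      proof
        fix x assume "x \<in> ?A"
        then show "x \<in> ?B" by (intro image_eqI[of _ _ "x - z"]) auto
      qed
    qed auto
    finally have "{x. p \<bullet> x = 1} = (\<lambda>y. z + y) ` {y. z \<bullet> y = 0}" .
    with np show False by (auto simp: affine_parallel_def)
  qed
  define F :: "real^2" where "F = vector [- z$2 / D, z$1 / D]"
  have F: "F$1 = - z$2 / D" "F$2 = z$1 / D" by (simp_all add: F_def)
  have "p \<bullet> F = 1" "z \<bullet> F = 0"
    using \<open>D \<noteq> 0\<close> by (simp_all add: inner_vec_def sum_2 F field_simps) (simp add: D_def)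
  moreover have "x = F" if "p \<bullet> x = 1" "z \<bullet> x = 0" for x
  proof -
    have x: "p$1 * x$1 + p$2 * x$2 = 1" "z$1 * x$1 + z$2 * x$2 = 0"
      using that by (simp_all add: inner_vec_def sum_2)
    \<comment> \<open>Cramer's rule.\<close>
    have "x$1 * D = p$2 * (z$1 * x$1 + z$2 * x$2) - z$2 * (p$1 * x$1 + p$2 * x$2)"
      "x$2 * D = z$1 * (p$1 * x$1 + p$2 * x$2) - p$1 * (z$1 * x$1 + z$2 * x$2)"
      by (simp_all add: D_def algebra_simps)
    then have "x$1 * D = - z$2" "x$2 * D = z$1" by (simp_all add: x)
    then show ?thesis
      using \<open>D \<noteq> 0\<close> by (simp add: vec_eq_iff forall_2 F field_simps)
  qed
  ultimately have "{x. p \<bullet> x = 1} \<inter> {y. z \<bullet> y = 0} = {F}" by blast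
  then show thesis by (rule that)
qed

theorem proposition4p1:
  fixes R :: real and l m mperp :: "(real^2) set" and z w :: "real^2"
  assumes "R > 0"
    and "is_line l" and "0 \<notin> l"
    and "z \<in> l"
    and "w = radial_cone R z"
    and "m = affine hull {0, z}"
    and "mperp = orthogonal_comp m"
  shows "(\<not> affine_parallel mperp l \<longrightarrow>
            (\<exists>F. l \<inter> mperp = {F} \<and>
                 is_tangent_line (carrier_conic (radial_cone R ` l)) w (affine hull {F, w})))
       \<and> (affine_parallel mperp l \<longrightarrow>
            (\<exists>T. is_tangent_line (carrier_conic (radial_cone R ` l)) w T \<and> affine_parallel T l))"
proof -
  obtain p where p: "p \<noteq> 0" "l = {x. p \<bullet> x = 1}"
    using line_not_through_origin assms(2,3) by blast
  have mperp: "mperp = {y. z \<bullet> y = 0}"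
    using assms(6,7) by (simp add: orthogonal_comp_affine_hull_origin)
  have carrier: "carrier_conic (radial_cone R ` l) = focal_conic R p"
    using carrier_conic_radial_cone_line[OF assms(1) p(1)] by (simp add: p(2))
  have arc: "radial_cone R ` l = {x. norm x = R * (1 - p \<bullet> x) \<and> p \<bullet> x > 0}"
    using radial_cone_image_line[OF assms(1)] by (simp add: p(2))
  have w_arc: "w \<in> radial_cone R ` l" using assms(4,5) by simp
  then have w: "norm w = R * (1 - p \<bullet> w)" "p \<bullet> w > 0" unfolding arc by auto
  have "radial_cone R ` l \<subseteq> focal_conic R p"
    unfolding arc by (auto simp: focal_conic_def power_mult_distrib)
  then have lim: "w islimpt focal_conic R p"
    using islimpt_radial_cone_image_line[OF assms(1-3) w_arc] islimpt_subset by blast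
  note tangent = is_tangent_line_focal_conic[OF assms(1) w lim]
  let ?g = "w + (R * norm w) *\<^sub>R p"
  have perp_w: "w \<bullet> y = 0" if "z \<bullet> y = 0" for y
    using that assms(5) by (simp add: radial_cone_def)
  have "\<exists>F. l \<inter> mperp = {F} \<and> is_tangent_line (focal_conic R p) w (affine hull {F, w})"
    if "\<not> affine_parallel mperp l"
  proof -
    have "p \<bullet> z = 1" using assms(4) by (simp add: p(2))
    from perpendicular_meets_line[OF this that[unfolded mperp p(2)]]
    obtain F where lF: "l \<inter> mperp = {F}" unfolding mperp p(2) .
    then have F: "p \<bullet> F = 1" "w \<bullet> F = 0" using perp_w unfolding mperp p(2) by auto
    \<comment> \<open>\<open>F\<close> is orthogonal to the nonzero vector \<open>w\<close>.\<close>
    have "F \<noteq> w" using F(2) w(2) by auto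
    have "?g \<bullet> (F - w) = R * norm w * (1 - p \<bullet> w) - (norm w)\<^sup>2"
      using F by (simp add: inner_simps power2_norm_eq_inner algebra_simps)
    also have "\<dots> = norm w * (R * (1 - p \<bullet> w)) - (norm w)\<^sup>2" by (simp add: algebra_simps)
    also have "\<dots> = 0" unfolding w(1)[symmetric] by (simp add: power2_eq_square)
    finally have gF: "?g \<bullet> F = ?g \<bullet> w" by (simp add: inner_diff_right)
    have "is_tangent_line (focal_conic R p) w (affine hull {F, w})"
    proof (rule tangent)
      show "is_line (affine hull {F, w})"
        using \<open>F \<noteq> w\<close> by (simp add: is_line_def aff_dim_2)
      show "w \<in> affine hull {F, w}" by (simp add: hull_inc)
      have "affine hull {F, w} \<subseteq> {x. ?g \<bullet> x = ?g \<bullet> w}"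
        using gF by (intro hull_minimal affine_hyperplane) auto
      then show "?g \<bullet> (x - w) = 0" if "x \<in> affine hull {F, w}" for x
        using that by (auto simp: inner_diff_right)
    qed
    with lF show ?thesis by blast
  qed
  moreover have "\<exists>T. is_tangent_line (focal_conic R p) w T \<and> affine_parallel T l"
    if par: "affine_parallel mperp l"
  proof -
    obtain a where a: "l = (\<lambda>y. a + y) ` mperp"
      using par unfolding affine_parallel_def by blast
    have dir: "p \<bullet> y = 0" "w \<bullet> y = 0" if "y \<in> mperp" for y
    proof -
      have "0 \<in> mperp" by (simp add: mperp)
      then have "a + 0 \<in> l" "a + y \<in> l" using a that by blast+
      then show "p \<bullet> y = 0" by (simp add: p(2) inner_add_right)
      show "w \<bullet> y = 0" using that perp_w by (simp add: mperp)
    qed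
    define T where "T = (\<lambda>y. w + y) ` mperp"
    have Tl: "l = (\<lambda>x. (a - w) + x) ` T"
      unfolding T_def a by (simp add: image_image)
    have lT: "T = (\<lambda>x. (w - a) + x) ` l"
      unfolding T_def a by (simp add: image_image)
    have "is_tangent_line (focal_conic R p) w T"
    proof (rule tangent)
      show "is_line T"
        using assms(2) unfolding lT is_line_def
        by (simp add: affine_translation[symmetric] aff_dim_translation_eq)
      show "w \<in> T" by (auto simp: T_def mperp intro!: image_eqI[of _ _ 0])
      show "?g \<bullet> (x - w) = 0" if "x \<in> T" for x
        using that dir by (auto simp: T_def inner_add_left)
    qed
    with Tl show ?thesis unfolding affine_parallel_def by blast
  qed
  ultimately show ?thesis by (simp add: carrier)
qed

end
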